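(* Let $K=\mathbb{Q}(\sqrt{-d})$ with $d>0$ squarefree, let $p$ be a prime and $S=\{p\}$. (1) If $p\ge 11$ and $(-d/p)\neq 1$, then $K$ is $S$-norm-Euclidean only if $d\in\{1,2,3,7,11\}$. (2) If $p=2$ and $-d\not\equiv 1\pmod 8$, then $K$ is $S$-norm-Euclidean if and only if $d\in\{1,2,3,5,6,10,11,19\}$. (3) If $p\in\{3,5,7\}$ and $(-d/p)\neq 1$, then $K$ is $S$-norm-Euclidean if and only if one of the following holds: $p=3$ and $d\in\{1,3,7,11,15\}$; $p=5$ and $d\in\{2,3,7,15,35\}$; $p=7$ and $d\in\{1,2,7,11,35\}$.
   Context: $(n/p)$ is the Legendre symbol. Put $w=\sqrt{-d}$ if $-d\equiv 2,3\pmod 4$ and $w=(1+\sqrt{-d})/2$ if $-d\equiv 1\pmod 4$. The norm is $N(x+y\sqrt{-d})=x^2+dy^2$. For $S=\{p\}$, let $T=\{p^n: n\ge 0\}$ and $\mathcal{O}_S=\{(a+bw)/c: a,b\in\mathbb{Z}, c\in T\}$. For nonzero $\xi\in K$, $N_S(\xi)$ is the positive rational obtained from $N(\xi)$ by deleting the prime $p$ from the prime factorizations of its numerator and denominator; $N_S(0)=0$. $K$ is $S$-norm-Euclidean if for every $\xi\in K$ there exists $\gamma\in\mathcal{O}_S$ with $N_S(\xi-\gamma)<1$. *)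

theory Defs
  imports Complex_Main "HOL-Number_Theory.Number_Theory"
    "HOL-Computational_Algebra.Squarefree"
begin

definition sqrt_neg :: "nat \<Rightarrow> complex" where
  "sqrt_neg d = csqrt (- of_nat d)"

definition quad_field :: "nat \<Rightarrow> complex set" where
  "quad_field d = {of_rat x + of_rat y * sqrt_neg d | x y :: rat. True}"

(* For squarefree d the else-branch is the case -d = 2 or 3 (mod 4). *)
definition quad_w :: "nat \<Rightarrow> complex" where
  "quad_w d = (if [- int d = 1] (mod 4) then (1 + sqrt_neg d) / 2 else sqrt_neg d)"

definition S_integers :: "nat \<Rightarrow> nat \<Rightarrow> complex set" where
  "S_integers d p =
     {(of_int a + of_int b * quad_w d) / of_nat c | a b c. c \<in> {p ^ n | n. True}}"

(* Only meaningful on quad_field d with d > 0, where the coordinates x, y are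
   unique; see quad_norm_eq. *)
definition quad_norm :: "nat \<Rightarrow> complex \<Rightarrow> rat" where
  "quad_norm d z =
     (THE r. \<exists>x y. z = of_rat x + of_rat y * sqrt_neg d \<and> r = x\<^sup>2 + of_nat d * y\<^sup>2)"

(* quotient_of yields numerator and denominator in lowest terms. *)
definition delete_prime :: "nat \<Rightarrow> rat \<Rightarrow> rat" where
  "delete_prime p r =
     (let (a, b) = quotient_of r
      in of_int (a div int p ^ multiplicity (int p) a) /
         of_int (b div int p ^ multiplicity (int p) b))"

definition S_norm :: "nat \<Rightarrow> nat \<Rightarrow> complex \<Rightarrow> rat" where
  "S_norm d p z = (if z = 0 then 0 else delete_prime p (quad_norm d z))"

definition S_norm_Euclidean :: "nat \<Rightarrow> nat \<Rightarrow> bool" where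
  "S_norm_Euclidean d p \<longleftrightarrow>
     (\<forall>\<xi> \<in> quad_field d. \<exists>\<gamma> \<in> S_integers d p. S_norm d p (\<xi> - \<gamma>) < 1)"

lemma sqrt_neg_altdef: "sqrt_neg d = \<i> * of_real (sqrt (real d))"
  using csqrt_of_real_nonpos[of "- of_nat d"] by (simp add: sqrt_neg_def)

lemma of_rat_complex: "(of_rat x :: complex) = of_real (of_rat x)"
  by (cases x) (simp add: of_rat_rat)

lemma quad_coords_unique:
  assumes "d > 0"
    and "of_rat x + of_rat y * sqrt_neg d = of_rat x' + of_rat y' * sqrt_neg d"
  shows "x = x' \<and> y = y'"
  using assms by (auto simp: sqrt_neg_altdef of_rat_complex complex_eq_iff)

lemma quad_norm_eq:
  assumes "d > 0"
  shows "quad_norm d (of_rat x + of_rat y * sqrt_neg d) = x\<^sup>2 + of_nat d * y\<^sup>2"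
  unfolding quad_norm_def
  by (rule the_equality) (auto dest: quad_coords_unique[OF assms])

lemma S_integers_subset_quad_field: "S_integers d p \<subseteq> quad_field d"
proof
  fix z assume "z \<in> S_integers d p"
  then obtain a b c where z: "z = (of_int a + of_int b * quad_w d) / of_nat c"
    by (auto simp: S_integers_def)
  have "\<exists>x y. z = of_rat x + of_rat y * sqrt_neg d"
  proof (cases "[- int d = 1] (mod 4)")
    case True
    have "z = of_rat ((of_int a + of_int b / 2) / of_nat c)
              + of_rat (of_int b / 2 / of_nat c) * sqrt_neg d"
      using True by (simp add: z quad_w_def of_rat_add of_rat_mult of_rat_divide add_divide_distrib distrib_left)
    thus ?thesis by blast
  next
    case False
    have "z = of_rat (of_int a / of_nat c) + of_rat (of_int b / of_nat c) * sqrt_neg d"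
      using False by (simp add: z quad_w_def of_rat_divide add_divide_distrib)
    thus ?thesis by blast
  qed
  thus "z \<in> quad_field d" by (auto simp: quad_field_def)
qed

end

theory Submission imports Defs begin

text \<open>Multiplication by \<open>p\<close> does not change the \<open>S\<close>-norm, so only the orbit of \<open>\<xi>\<close> under
  multiplication by \<open>p\<close> modulo the ring of integers matters. If \<open>p\<close> does not split, a
  coordinate vector with entries not both divisible by \<open>p\<close> has norm prime to \<open>p\<close>, except for
  one factor \<open>p\<close> when \<open>p\<close> is ramified and a factor 4 when \<open>p = 2\<close> is inert.

  Non-Euclidean cases: the orbits of \<open>(1 + \<surd>-d)/2\<close> and \<open>(1 + \<surd>-d)/4\<close> for odd \<open>p\<close>, and of
  \<open>\<surd>-d/3\<close>, \<open>(1 + \<surd>-d)/3\<close> and \<open>(1 + \<surd>-d)/6\<close> for \<open>p = 2\<close>, stay too far from the integers,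
  because the numerators keep their residues modulo 2, respectively 3.

  Euclidean cases: after multiplying \<open>\<xi>\<close> by a power of \<open>p\<close>, an integer \<open>\<beta>\<close> is good enough if it
  has norm distance below 1, or if \<open>p\<close> divides its norm and it has norm distance below \<open>p\<close>. The
  unit discs suffice for \<open>d = 1, 2, 3, 7, 11\<close>, together with a doubling of \<open>\<xi>\<close> for
  \<open>d = 5, 6, 19\<close>; for \<open>d = 10, 15, 35\<close> the larger discs around the ramified prime ideal fill
  the gaps.\<close>

section \<open>Parts of integers and rationals prime to \<open>p\<close>\<close>

definition prime_free :: "int \<Rightarrow> int \<Rightarrow> int" where
  "prime_free p a = a div p ^ multiplicity p a"

lemma prime_free_decomp: "a = p ^ multiplicity p a * prime_free p a"
  by (simp add: prime_free_def multiplicity_dvd)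

lemma prime_free_0 [simp]: "prime_free p 0 = 0"
  by (simp add: prime_free_def)

lemma prime_free_eq_0_iff [simp]: "prime_free p a = 0 \<longleftrightarrow> a = 0"
  using prime_free_decomp[of a p] by auto

lemma prime_free_mult:
  assumes "prime p"
  shows "prime_free p (a * b) = prime_free p a * prime_free p b"
proof (cases "a = 0 \<or> b = 0")
  case False
  then have "multiplicity p (a * b) = multiplicity p a + multiplicity p b"
    using prime_elem_multiplicity_mult_distrib[OF prime_imp_prime_elem[OF assms]] by simp
  then show ?thesis
    by (simp add: prime_free_def power_add div_mult_div_if_dvd multiplicity_dvd)
qed auto

lemma prime_free_not_dvd: "\<not> p dvd a \<Longrightarrow> prime_free p a = a"
  by (simp add: prime_free_def not_dvd_imp_multiplicity_0)

lemma prime_free_power_self [simp]: "prime p \<Longrightarrow> prime_free p (p ^ n) = 1"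
  for p :: int
  using prime_gt_1_int[of p] by (simp add: prime_free_def multiplicity_same_power')

lemma prime_free_eqI:
  assumes "prime p" "\<not> p dvd b" "a = p ^ n * b"
  shows "prime_free p a = b"
  using assms by (simp add: prime_free_mult prime_free_not_dvd)

lemma prime_free_pos:
  assumes "prime p" "a > 0"
  shows "prime_free p a > 0"
  using assms prime_free_decomp[of a p] prime_gt_0_int[of p]
  by (metis zero_less_mult_pos zero_less_power)

lemma prime_free_le:
  assumes "prime p" "a \<ge> 0"
  shows "prime_free p a \<le> a"
proof (cases "a = 0")
  case False
  then have "prime_free p a > 0" using assms by (simp add: prime_free_pos)
  moreover have "p ^ multiplicity p a \<ge> 1"
    using prime_gt_0_int[OF assms(1)] by (simp add: int_one_le_iff_zero_less)
  ultimately show ?thesis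
    using prime_free_decomp[of a p] mult_right_mono[of 1 "p ^ multiplicity p a" "prime_free p a"]
    by simp
qed simp

lemma prime_free_le_dvd:
  assumes "prime p" "a \<ge> 0" "p dvd a"
  shows "p * prime_free p a \<le> a"
proof -
  obtain c where c: "a = p * c" using assms(3) by blast
  have "c \<ge> 0" using c assms prime_gt_0_int[OF assms(1)] by (simp add: zero_le_mult_iff)
  then have "prime_free p c \<le> c" by (rule prime_free_le[OF assms(1)])
  moreover have "prime_free p a = prime_free p c"
    using c assms(1) prime_free_power_self[of p 1] by (simp add: prime_free_mult)
  ultimately show ?thesis using c prime_gt_0_int[OF assms(1)] by simp
qed

text \<open>Cross-multiplying with the reduced fraction and using that \<open>prime_free\<close> is
  multiplicative makes the two quotients agree. Later fractions thus need not be in lowest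
  terms.\<close>

lemma delete_prime_divide:
  assumes p: "prime p" and b: "b \<noteq> 0"
  shows "delete_prime p (of_int a / of_int b) =
    of_int (prime_free (int p) a) / of_int (prime_free (int p) b)"
proof -
  obtain a' b' where q: "quotient_of (of_int a / of_int b) = (a', b')"
    by (cases "quotient_of (of_int a / of_int b)") auto
  have b': "b' > 0" using q quotient_of_denom_pos by blast
  have "(of_int a :: rat) / of_int b = of_int a' / of_int b'"
    using q by (rule quotient_of_div)
  then have "(of_int (a * b') :: rat) = of_int (a' * b)"
    using b b' by (simp add: field_simps)
  then have "a * b' = a' * b" using of_int_eq_iff by blast
  then have eq: "prime_free (int p) a * prime_free (int p) b' =
      prime_free (int p) a' * prime_free (int p) b"
    using p by (metis prime_free_mult prime_nat_int_transfer)
  have "delete_prime p (of_int a / of_int b) =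
      of_int (prime_free (int p) a') / of_int (prime_free (int p) b')"
    by (simp add: delete_prime_def q prime_free_def)
  also have "\<dots> = of_int (prime_free (int p) a) / of_int (prime_free (int p) b)"
  proof -
    have "(of_int (prime_free (int p) a * prime_free (int p) b') :: rat) =
      of_int (prime_free (int p) a' * prime_free (int p) b)"
      using eq by simp
    then show ?thesis using b b' by (simp add: field_simps)
  qed
  finally show ?thesis .
qed

lemma delete_prime_scale:
  assumes "prime p"
  shows "delete_prime p (of_nat p ^ k * r) = delete_prime p r"
proof -
  obtain a b where r: "r = of_int a / of_int b" "b > 0"
    using quotient_of_div quotient_of_denom_pos by (metis surj_pair)
  have "of_nat p ^ k * r = of_int (int p ^ k * a) / of_int b"
    using r by simp
  then show ?thesis
    using r assms by (simp only: delete_prime_divide prime_free_mult) (simp add: delete_prime_divide prime_free_mult)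
qed

text \<open>The denominator is prime to \<open>p\<close> and stays as it is. The numerator never
  grows, and if \<open>p\<close> divides it, it shrinks at least by the factor \<open>p\<close>;
  then a quotient below \<open>p\<close> is good enough.\<close>

lemma delete_prime_less_1:
  assumes p: "prime p" and M: "M > 0" "\<not> int p dvd M" and A: "A \<ge> 0"
    and less: "of_int A / of_int M < (1 :: rat) \<or>
      int p dvd A \<and> of_int A / of_int M < (of_nat p :: rat)"
  shows "delete_prime p (of_int A / of_int M) < 1"
proof -
  have pp: "prime (int p)" using p by simp
  have p0: "int p > 0" using prime_gt_0_int[OF pp] .
  have "prime_free (int p) A < M"
    using less
  proof
    assume "of_int A / of_int M < (1 :: rat)"
    then have "A < M" using M by (simp add: divide_less_eq)
    then show ?thesis using prime_free_le[OF pp A] by simp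
  next
    assume *: "int p dvd A \<and> of_int A / of_int M < (of_nat p :: rat)"
    then have "(of_int A :: rat) < of_int (int p * M)" using M by (simp add: divide_less_eq)
    then have "A < int p * M" by (simp only: of_int_less_iff)
    then have "int p * prime_free (int p) A < int p * M"
      using prime_free_le_dvd[OF pp A] * by linarith
    then show ?thesis using p0 by simp
  qed
  then show ?thesis
    using M p by (simp add: delete_prime_divide prime_free_not_dvd)
qed

section \<open>Coordinates of \<open>S\<close>-integers and of the \<open>S\<close>-norm\<close>

lemma S_norm_coords:
  assumes "d > 0"
  shows "S_norm d p (of_rat x + of_rat y * sqrt_neg d) = delete_prime p (x\<^sup>2 + of_nat d * y\<^sup>2)"
proof (cases "of_rat x + of_rat y * sqrt_neg d = 0")
  case True
  then have "x = 0 \<and> y = 0" using quad_coords_unique[OF assms, of x y 0 0] by simp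
  then show ?thesis by (simp add: S_norm_def delete_prime_def)
qed (simp add: S_norm_def quad_norm_eq[OF assms])

text \<open>The numbers \<open>(a + b * sqrt_neg d) / 2\<close> with this property form the span of
  1 and \<open>quad_w d\<close>. Doubled coordinates stay integral for both shapes of
  \<open>quad_w d\<close>.\<close>

definition quad_int_coords :: "nat \<Rightarrow> int \<Rightarrow> int \<Rightarrow> bool" where
  "quad_int_coords d a b \<longleftrightarrow> (if d mod 4 = 3 then even (a - b) else even a \<and> even b)"

lemma cong_neg_1_mod_4_iff: "[- int d = 1] (mod 4) \<longleftrightarrow> d mod 4 = 3"
  proof -
  have "(- int d) mod 4 = 1 \<longleftrightarrow> int d mod 4 = 3" by presburger
  also have "\<dots> \<longleftrightarrow> d mod 4 = 3" by presburger
  finally show ?thesis by (simp add: cong_def)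
qed

lemma S_integers_iff:
  "z \<in> S_integers d p \<longleftrightarrow> (\<exists>a b k. quad_int_coords d a b \<and>
     z = of_rat (of_int a / (2 * of_nat p ^ k)) + of_rat (of_int b / (2 * of_nat p ^ k)) * sqrt_neg d)"
  (is "?l \<longleftrightarrow> ?r")
proof (cases "d mod 4 = 3")
  case True
  then have w: "quad_w d = (1 + sqrt_neg d) / 2"
    by (simp add: quad_w_def cong_neg_1_mod_4_iff)
  show ?thesis
  proof
    assume ?l
    then obtain a b k where "z = (of_int a + of_int b * quad_w d) / of_nat (p ^ k)"
      by (auto simp: S_integers_def)
    then have "z = of_rat (of_int (2 * a + b) / (2 * of_nat p ^ k))
        + of_rat (of_int b / (2 * of_nat p ^ k)) * sqrt_neg d"
      by (simp add: w of_rat_add of_rat_mult of_rat_divide of_rat_power add_divide_distrib distrib_left)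
    moreover have "quad_int_coords d (2 * a + b) b" using True by (simp add: quad_int_coords_def)
    ultimately show ?r by blast
  next
    assume ?r
    then obtain a b k where c: "quad_int_coords d a b" and
      z: "z = of_rat (of_int a / (2 * of_nat p ^ k)) + of_rat (of_int b / (2 * of_nat p ^ k)) * sqrt_neg d"
      by blast
    obtain c where "a - b = 2 * c" using c True unfolding quad_int_coords_def by (metis evenE)
    then have c: "a = 2 * c + b" by simp
    have "z = (of_int c + of_int b * quad_w d) / of_nat (p ^ k)"
      by (simp add: z c w of_rat_add of_rat_mult of_rat_divide of_rat_power add_divide_distrib distrib_left)
    then show ?l unfolding S_integers_def by blast
  qed
next
  case False
  then have w: "quad_w d = sqrt_neg d"
    by (simp add: quad_w_def cong_neg_1_mod_4_iff)
  show ?thesis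
  proof
    assume ?l
    then obtain a b k where "z = (of_int a + of_int b * quad_w d) / of_nat (p ^ k)"
      by (auto simp: S_integers_def)
    then have "z = of_rat (of_int (2 * a) / (2 * of_nat p ^ k))
        + of_rat (of_int (2 * b) / (2 * of_nat p ^ k)) * sqrt_neg d"
      by (simp add: w of_rat_add of_rat_mult of_rat_divide of_rat_power add_divide_distrib)
    moreover have "quad_int_coords d (2 * a) (2 * b)" using False by (simp add: quad_int_coords_def)
    ultimately show ?r by blast
  next
    assume ?r
    then obtain a b k where c: "quad_int_coords d a b" and
      z: "z = of_rat (of_int a / (2 * of_nat p ^ k)) + of_rat (of_int b / (2 * of_nat p ^ k)) * sqrt_neg d"
      by blast
    obtain a' b' where c: "a = 2 * a'" "b = 2 * b'"
      using c False by (auto simp: quad_int_coords_def elim!: evenE)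
    have "z = (of_int a' + of_int b' * quad_w d) / of_nat (p ^ k)"
      by (simp add: z c w of_rat_add of_rat_mult of_rat_divide of_rat_power add_divide_distrib)
    then show ?l unfolding S_integers_def by blast
  qed
qed

definition quad_form :: "nat \<Rightarrow> rat \<Rightarrow> rat \<Rightarrow> rat" where
  "quad_form d x y = x\<^sup>2 + of_nat d * y\<^sup>2"

text \<open>Multiplication by \<open>p ^ k\<close> preserves the \<open>S\<close>-norm and clears
  the denominator of \<gamma>. Approximating \<xi> by \<open>S\<close>-integers thus means
  approximating some multiple of \<xi> by a power of \<open>p\<close> by elements with denominator
  1.\<close>

lemma S_norm_Euclidean_iff:
  assumes d: "d > 0" and p: "prime p"
  shows "S_norm_Euclidean d p \<longleftrightarrow> (\<forall>x y. \<exists>a b k. quad_int_coords d a b \<and>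
    delete_prime p (quad_form d (of_nat p ^ k * x - of_int a / 2) (of_nat p ^ k * y - of_int b / 2)) < 1)"
proof -
  have eq: "S_norm d p (of_rat x + of_rat y * sqrt_neg d -
      (of_rat (of_int a / (2 * of_nat p ^ k)) + of_rat (of_int b / (2 * of_nat p ^ k)) * sqrt_neg d)) =
    delete_prime p (quad_form d (of_nat p ^ k * x - of_int a / 2) (of_nat p ^ k * y - of_int b / 2))"
    (is "S_norm d p ?z = _") for x y a b k
  proof -
    have "?z = of_rat (x - of_int a / (2 * of_nat p ^ k)) + of_rat (y - of_int b / (2 * of_nat p ^ k)) * sqrt_neg d"
      by (simp add: of_rat_diff left_diff_distrib)
    then have "S_norm d p ?z = delete_prime p (quad_form d (x - of_int a / (2 * of_nat p ^ k)) (y - of_int b / (2 * of_nat p ^ k)))"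
      using d by (simp only: S_norm_coords quad_form_def)
    also have "\<dots> = delete_prime p (of_nat p ^ (2 * k) *
        quad_form d (x - of_int a / (2 * of_nat p ^ k)) (y - of_int b / (2 * of_nat p ^ k)))"
      by (rule delete_prime_scale[OF p, symmetric])
    also have "of_nat p ^ (2 * k) *
        quad_form d (x - of_int a / (2 * of_nat p ^ k)) (y - of_int b / (2 * of_nat p ^ k)) =
        quad_form d (of_nat p ^ k * (x - of_int a / (2 * of_nat p ^ k)))
          (of_nat p ^ k * (y - of_int b / (2 * of_nat p ^ k)))"
      by (simp only: quad_form_def power_mult_distrib power_mult) (simp add: algebra_simps power_mult power_commutes flip: power_mult)
    also have "of_nat p ^ k * (x - of_int a / (2 * of_nat p ^ k)) = of_nat p ^ k * x - of_int a / 2"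
      using prime_gt_0_nat[OF p] by (simp add: right_diff_distrib)
    also have "of_nat p ^ k * (y - of_int b / (2 * of_nat p ^ k)) = of_nat p ^ k * y - of_int b / 2"
      using prime_gt_0_nat[OF p] by (simp add: right_diff_distrib)
    finally show ?thesis .
  qed
  show ?thesis
    unfolding S_norm_Euclidean_def quad_field_def Bex_def S_integers_iff
    by (simp add: eq[symmetric]) (smt (verit))
qed

section \<open>Criteria for and against being \<open>S\<close>-norm-Euclidean\<close>

lemma quad_int_coords_norm:
  assumes "quad_int_coords d a b"
  shows "4 dvd a\<^sup>2 + int d * b\<^sup>2"
proof (cases "d mod 4 = 3")
  case True
  obtain c where "a - b = 2 * c" using assms True unfolding quad_int_coords_def by (metis evenE)
  then have c: "a = b + 2 * c" by simp
  obtain e where "d = 4 * e + 3" using True by (metis mult_div_mod_eq)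
  then have "a\<^sup>2 + int d * b\<^sup>2 = 4 * (c\<^sup>2 + b * c + (int e + 1) * b\<^sup>2)"
    by (simp add: c power2_eq_square algebra_simps)
  then show ?thesis by simp
next
  case False
  then obtain a' b' where "a = 2 * a'" "b = 2 * b'"
    using assms unfolding quad_int_coords_def by (metis evenE)
  then have "a\<^sup>2 + int d * b\<^sup>2 = 4 * (a'\<^sup>2 + int d * b'\<^sup>2)"
    by (simp add: power2_eq_square algebra_simps)
  then show ?thesis by simp
qed

text \<open>After the power of \<open>p\<close> in a common denominator is cleared, one more factor
  \<open>p\<close> is multiplied in. This spare \<open>p\<close> in both numerators makes the cross
  terms of a norm vanish modulo \<open>p\<close>.\<close>

lemma common_p_integral_multiple:
  fixes x y :: rat
  assumes p: "prime p"
  obtains s X Y m where "m > 0" "\<not> int p dvd m"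
    "of_nat p ^ s * x = of_nat p * of_int X / of_int m"
    "of_nat p ^ s * y = of_nat p * of_int Y / of_int m"
proof -
  obtain a b where x: "x = of_int a / of_int b" "b > 0"
    using quotient_of_div quotient_of_denom_pos by (metis surj_pair)
  obtain a' b' where y: "y = of_int a' / of_int b'" "b' > 0"
    using quotient_of_div quotient_of_denom_pos by (metis surj_pair)
  define m where "m = prime_free (int p) (b * b')"
  define t where "t = multiplicity (int p) (b * b')"
  have pp: "prime (int p)" using p by simp
  have M: "b * b' = int p ^ t * m" unfolding m_def t_def by (rule prime_free_decomp)
  have m0: "m > 0" using prime_free_pos[OF pp] x y by (simp add: m_def)
  have "\<not> int p dvd m"
    unfolding m_def prime_free_def
    by (rule multiplicity_decompose) (use x y prime_gt_1_int[OF pp] in auto)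
  moreover have eq: "of_int b * of_int b' = (of_nat p ^ t * of_int m :: rat)"
    using arg_cong[OF M, of "of_int :: int \<Rightarrow> rat"] by simp
  have "of_nat p ^ Suc t * x = of_nat p * of_int (a * b') / of_int m"
  proof -
    have "of_nat p ^ Suc t * x * of_int m = of_nat p * x * (of_nat p ^ t * of_int m)" by simp
    also have "\<dots> = of_nat p * of_int (a * b')"
      using x by (simp flip: eq)
    finally show ?thesis using m0 by (simp add: field_simps)
  qed
  moreover have "of_nat p ^ Suc t * y = of_nat p * of_int (a' * b) / of_int m"
  proof -
    have "of_nat p ^ Suc t * y * of_int m = of_nat p * y * (of_nat p ^ t * of_int m)" by simp
    also have "\<dots> = of_nat p * of_int (a' * b)"
      using y by (simp flip: eq)
    finally show ?thesis using m0 by (simp add: field_simps)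
  qed
  ultimately show thesis using m0 that by blast
qed

text \<open>If \<open>p * \<alpha> / m\<close> lies within norm distance \<open>p\<close> of an integer whose norm \<open>p\<close> divides, then \<open>p\<close>
  also divides the numerator of the norm of the difference.\<close>

definition covered :: "nat \<Rightarrow> nat \<Rightarrow> rat \<Rightarrow> rat \<Rightarrow> bool" where
  "covered d p x y \<longleftrightarrow> (\<exists>a b. quad_int_coords d a b \<and>
    (quad_form d (x - of_int a / 2) (y - of_int b / 2) < 1 \<or>
     4 * int p dvd a\<^sup>2 + int d * b\<^sup>2 \<and> quad_form d (x - of_int a / 2) (y - of_int b / 2) < of_nat p))"

lemma S_norm_EuclideanI:
  assumes d: "d > 0" and p: "prime p"
    and cover: "\<And>x y. \<exists>k. covered d p (of_nat p ^ k * x) (of_nat p ^ k * y)"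
  shows "S_norm_Euclidean d p"
  unfolding S_norm_Euclidean_iff[OF d p]
proof (intro allI)
  fix x y :: rat
  obtain s X Y m where m: "m > 0" "\<not> int p dvd m"
    and x: "of_nat p ^ s * x = of_nat p * of_int X / of_int m"
    and y: "of_nat p ^ s * y = of_nat p * of_int Y / of_int m"
    by (rule common_p_integral_multiple[OF p])
  \<comment> \<open>The hypothesis is applied after multiplication by \<open>p ^ s\<close>, so that
    the covered multiple keeps the factor \<open>p\<close> in its numerators.\<close>
  obtain k where k: "covered d p (of_nat p ^ k * (of_nat p ^ s * x)) (of_nat p ^ k * (of_nat p ^ s * y))"
    using cover by blast
  define U where "U = int p ^ k * X"
  define V where "V = int p ^ k * Y"
  have xU: "of_nat p ^ (k + s) * x = of_nat p * of_int U / of_int m"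
    using x by (simp add: U_def power_add mult.assoc)
  have yV: "of_nat p ^ (k + s) * y = of_nat p * of_int V / of_int m"
    using y by (simp add: V_def power_add mult.assoc)
  define N where "N a b = quad_form d (of_nat p ^ (k + s) * x - of_int a / 2)
    (of_nat p ^ (k + s) * y - of_int b / 2)" for a b
  obtain a b where ab: "quad_int_coords d a b" and
    less: "N a b < 1 \<or> 4 * int p dvd a\<^sup>2 + int d * b\<^sup>2 \<and> N a b < of_nat p"
    using k unfolding covered_def N_def by (auto simp: power_add mult.assoc)
  obtain n where n: "a\<^sup>2 + int d * b\<^sup>2 = 4 * n"
    using quad_int_coords_norm[OF ab] by blast
  \<comment> \<open>All terms but the last contain a factor \<open>p\<close>, and \<open>n\<close>
    is the norm of the approximating integer: if \<open>p\<close> divides \<open>n\<close>, it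
    divides \<open>A\<close>.\<close>
  define A where "A = (int p)\<^sup>2 * (U\<^sup>2 + int d * V\<^sup>2) - int p * m * (U * a + int d * V * b) + m\<^sup>2 * n"
  have n': "(of_int n :: rat) = ((of_int a)\<^sup>2 + of_nat d * (of_int b)\<^sup>2) / 4"
    using arg_cong[OF n, of "of_int :: int \<Rightarrow> rat"] by simp
  have NA: "N a b = of_int A / of_int (m\<^sup>2)"
    using m(1) unfolding N_def xU yV A_def quad_form_def
    by (simp add: n' field_simps power2_eq_square)
  have "N a b \<ge> 0" by (simp add: N_def quad_form_def)
  then have A0: "A \<ge> 0" using m(1) unfolding NA by (simp add: zero_le_divide_iff)
  have dvdA: "int p dvd A" if "4 * int p dvd a\<^sup>2 + int d * b\<^sup>2"
  proof -
    have "int p dvd n" using that unfolding n by simp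
    then show ?thesis unfolding A_def by (simp add: power2_eq_square)
  qed
  have "delete_prime p (of_int A / of_int (m\<^sup>2)) < 1"
  proof (rule delete_prime_less_1[OF p _ _ A0])
    show "\<not> int p dvd m\<^sup>2"
      using m(2) p by (simp add: prime_dvd_power_iff)
  qed (use m less dvdA in \<open>auto simp: NA\<close>)
  then have "delete_prime p (N a b) < 1" by (simp only: NA)
  then show "\<exists>a b k. quad_int_coords d a b \<and>
    delete_prime p (quad_form d (of_nat p ^ k * x - of_int a / 2) (of_nat p ^ k * y - of_int b / 2)) < 1"
    using ab unfolding N_def by blast
qed

text \<open>The witness is \<open>(u + v * sqrt_neg d) / (2 * M)\<close>. Subtracting an integer
  from its multiple by \<open>p ^ k\<close> gives the displayed sum over four times the square of
  \<open>M\<close> as norm, and deleting \<open>p\<close> acts on numerator and denominator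
  separately.\<close>

lemma not_S_norm_Euclidean:
  assumes d: "d > 0" and p: "prime p" and M: "M > 0"
    and far: "\<And>k a b. quad_int_coords d a b \<Longrightarrow> prime_free (int p) (4 * M\<^sup>2) \<le>
      prime_free (int p) ((int p ^ k * u - M * a)\<^sup>2 + int d * (int p ^ k * v - M * b)\<^sup>2)"
  shows "\<not> S_norm_Euclidean d p"
proof
  assume "S_norm_Euclidean d p"
  then obtain a b k where ab: "quad_int_coords d a b" and
    less: "delete_prime p (quad_form d (of_nat p ^ k * (of_int u / of_int (2 * M)) - of_int a / 2)
      (of_nat p ^ k * (of_int v / of_int (2 * M)) - of_int b / 2)) < 1"
    unfolding S_norm_Euclidean_iff[OF d p] by blast
  define A where "A = (int p ^ k * u - M * a)\<^sup>2 + int d * (int p ^ k * v - M * b)\<^sup>2"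
  have "quad_form d (of_nat p ^ k * (of_int u / of_int (2 * M)) - of_int a / 2)
      (of_nat p ^ k * (of_int v / of_int (2 * M)) - of_int b / 2) = of_int A / of_int (4 * M\<^sup>2)"
    using M by (simp add: A_def quad_form_def field_simps power2_eq_square)
  then have "of_int (prime_free (int p) A) / of_int (prime_free (int p) (4 * M\<^sup>2)) < (1 :: rat)"
    using less delete_prime_divide[OF p, of "4 * M\<^sup>2" A] M by simp
  moreover have "prime_free (int p) (4 * M\<^sup>2) > 0"
    using M p by (intro prime_free_pos) auto
  ultimately have "prime_free (int p) A < prime_free (int p) (4 * M\<^sup>2)"
    by (simp add: divide_less_eq)
  then show False using far[OF ab, of k] by (simp add: A_def)
qed


section \<open>The power of a nonsplit prime in the norm of a primitive vector\<close>

lemma common_prime_power: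
  fixes p A B :: int
  assumes p: "prime p" and AB: "A \<noteq> 0 \<or> B \<noteq> 0"
  obtains j A0 B0 where "A = p ^ j * A0" "B = p ^ j * B0" "\<not> (p dvd A0 \<and> p dvd B0)"
proof -
  define j where "j = multiplicity p (gcd A B)"
  have "p ^ j dvd gcd A B" unfolding j_def by (rule multiplicity_dvd)
  then obtain A0 B0 where AB0: "A = p ^ j * A0" "B = p ^ j * B0" by (meson dvdE gcd_greatest_iff)
  have "\<not> (p dvd A0 \<and> p dvd B0)"
  proof
    assume "p dvd A0 \<and> p dvd B0"
    then have "p ^ Suc j dvd gcd A B"
      by (simp add: AB0 mult.commute[of p] mult_dvd_mono)
    moreover have "\<not> is_unit p" "gcd A B \<noteq> 0" using prime_gt_1_int[OF p] AB by auto
    ultimately show False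
      by (metis j_def power_dvd_iff_le_multiplicity Suc_n_not_le_n)
  qed
  with AB0 show thesis using that by blast
qed

lemma prime_free_norm_scale:
  assumes "prime p"
  shows "prime_free p ((p ^ j * A)\<^sup>2 + D * (p ^ j * B)\<^sup>2) = prime_free p (A\<^sup>2 + D * B\<^sup>2)"
proof -
  have "(p ^ j * A)\<^sup>2 + D * (p ^ j * B)\<^sup>2 = p ^ (2 * j) * (A\<^sup>2 + D * B\<^sup>2)"
    by (simp add: algebra_simps power_mult_distrib power_mult flip: power_mult)
  then show ?thesis using assms by (simp only: prime_free_mult prime_free_power_self)
qed

text \<open>If \<open>p\<close> divides the norm, it cannot divide \<open>B\<close>. Dividing by
  \<open>B\<close> modulo \<open>p\<close> would make \<open>- d\<close> a nonzero square unless
  \<open>p\<close> divides \<open>d\<close>. In that ramified case \<open>p\<close> divides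
  \<open>A\<close>, and squarefreeness of \<open>d\<close> leaves exactly one factor
  \<open>p\<close> in the norm.\<close>

lemma prime_free_norm_nonsplit:
  assumes p: "prime p" and sf: "squarefree d" and L: "Legendre (- int d) (int p) \<noteq> 1"
    and prim: "\<not> (int p dvd A \<and> int p dvd B)"
  shows "prime_free (int p) (A\<^sup>2 + int d * B\<^sup>2) = A\<^sup>2 + int d * B\<^sup>2 \<or>
    p dvd d \<and> int p dvd A \<and> int p * prime_free (int p) (A\<^sup>2 + int d * B\<^sup>2) = A\<^sup>2 + int d * B\<^sup>2"
proof (cases "int p dvd A\<^sup>2 + int d * B\<^sup>2")
  case True
  have pp: "prime (int p)" using p by simp
  have B: "\<not> int p dvd B"
  proof
    assume "int p dvd B"
    then have "int p dvd A\<^sup>2" using True by (simp add: dvd_add_left_iff power2_eq_square)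
    then show False using prim \<open>int p dvd B\<close> prime_dvd_power[OF pp] by blast
  qed
  have dvd_d: "p dvd d"
  proof (rule ccontr)
    assume ndvd: "\<not> p dvd d"
    have "coprime B (int p)"
      using prime_imp_coprime[OF pp B] by (simp add: coprime_commute)
    then obtain c where c: "[B * c = 1] (mod int p)" using cong_solve_coprime_int by blast
    have "[(A\<^sup>2 + int d * B\<^sup>2) * c\<^sup>2 = 0] (mod int p)"
      using True by (simp add: cong_0_iff)
    then have "[(A * c)\<^sup>2 + int d * (B * c)\<^sup>2 = 0] (mod int p)"
      by (simp add: algebra_simps power_mult_distrib)
    moreover have "[(A * c)\<^sup>2 + int d * (B * c)\<^sup>2 = (A * c)\<^sup>2 + int d * 1\<^sup>2] (mod int p)"
      by (intro cong_add cong_mult cong_pow c cong_refl)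
    ultimately have "[(A * c)\<^sup>2 + int d = 0] (mod int p)"
      by (simp add: cong_def)
    then have "[(A * c)\<^sup>2 = - int d] (mod int p)"
      by (simp add: cong_iff_dvd_diff)
    then have "QuadRes (int p) (- int d)" unfolding QuadRes_def by blast
    moreover have "\<not> [- int d = 0] (mod int p)" using ndvd by (simp add: cong_0_iff)
    ultimately show False using L by (simp add: Legendre_def)
  qed
  then have "int p dvd A\<^sup>2" using True by (metis dvd_add_left_iff dvd_mult2 of_nat_dvd_iff)
  then have A: "int p dvd A" using prime_dvd_power[OF pp] by blast
  obtain A' d' where A': "A = int p * A'" and d': "d = p * d'" using A dvd_d by blast
  have "\<not> p dvd d'"
  proof
    assume "p dvd d'"
    then have "p\<^sup>2 dvd d" by (simp add: d' power2_eq_square)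
    then show False using sf p unfolding squarefree_def by auto
  qed
  then have "\<not> int p dvd int d' * B\<^sup>2"
    using B pp by (simp add: prime_dvd_mult_iff prime_dvd_power_iff)
  then have "\<not> int p dvd int p * A'\<^sup>2 + int d' * B\<^sup>2" by (simp add: dvd_add_right_iff)
  moreover have eq: "A\<^sup>2 + int d * B\<^sup>2 = int p ^ 1 * (int p * A'\<^sup>2 + int d' * B\<^sup>2)"
    by (simp add: A' d' power2_eq_square algebra_simps)
  ultimately have "prime_free (int p) (A\<^sup>2 + int d * B\<^sup>2) = int p * A'\<^sup>2 + int d' * B\<^sup>2"
    by (rule prime_free_eqI[OF pp])
  then show ?thesis using dvd_d A eq by simp
qed (simp add: prime_free_not_dvd)

lemma square_ge_square:
  fixes a c :: int
  assumes "a \<noteq> 0" "c dvd a"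
  shows "c\<^sup>2 \<le> a\<^sup>2"
  using dvd_imp_le_int[OF assms] by (simp add: abs_le_square_iff)

text \<open>Removing an odd common factor keeps both entries odd, hence nonzero, so the norm is at
  least \<open>1 + d\<close>. If a ramified \<open>p\<close> still has to be deleted, the first
  entry is a nonzero multiple of \<open>p\<close>, which gives the second bound on
  \<open>c\<close>.\<close>

lemma prime_free_norm_odd_bound:
  assumes p: "prime p" "p \<noteq> 2" and sf: "squarefree d" and L: "Legendre (- int d) (int p) \<noteq> 1"
    and AB: "odd A" "odd B"
    and c: "c \<le> 1 + int d" "p dvd d \<Longrightarrow> int p * c \<le> (int p)\<^sup>2 + int d"
  shows "c \<le> prime_free (int p) (A\<^sup>2 + int d * B\<^sup>2)"
proof -
  have pp: "prime (int p)" using p by simp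
  obtain j A0 B0 where j: "A = int p ^ j * A0" "B = int p ^ j * B0"
    and prim: "\<not> (int p dvd A0 \<and> int p dvd B0)"
    using common_prime_power[OF pp, of A B] AB by (metis even_zero)
  have odd: "odd A0" "odd B0" using AB j by auto
  have "1\<^sup>2 \<le> B0\<^sup>2" using odd by (intro square_ge_square) auto
  then have B0: "int d * B0\<^sup>2 \<ge> int d" by (simp add: mult_le_cancel_left1)
  have A0: "1\<^sup>2 \<le> A0\<^sup>2" using odd by (intro square_ge_square) auto
  have "prime_free (int p) (A\<^sup>2 + int d * B\<^sup>2) = prime_free (int p) (A0\<^sup>2 + int d * B0\<^sup>2)"
    unfolding j by (rule prime_free_norm_scale[OF pp])
  moreover have "c \<le> prime_free (int p) (A0\<^sup>2 + int d * B0\<^sup>2)"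
    using prime_free_norm_nonsplit[OF p(1) sf L prim]
  proof
    assume "prime_free (int p) (A0\<^sup>2 + int d * B0\<^sup>2) = A0\<^sup>2 + int d * B0\<^sup>2"
    then show ?thesis using c(1) A0 B0 by simp
  next
    assume *: "p dvd d \<and> int p dvd A0 \<and>
      int p * prime_free (int p) (A0\<^sup>2 + int d * B0\<^sup>2) = A0\<^sup>2 + int d * B0\<^sup>2"
    then have "(int p)\<^sup>2 \<le> A0\<^sup>2" using odd by (intro square_ge_square) auto
    then have "int p * c \<le> int p * prime_free (int p) (A0\<^sup>2 + int d * B0\<^sup>2)"
      using * c(2) B0 by linarith
    then show ?thesis using prime_gt_0_int[OF pp] by simp
  qed
  ultimately show ?thesis by simp
qed

lemma square_mod_8:
  fixes A :: int
  shows "odd A \<Longrightarrow> A\<^sup>2 mod 8 = 1" and "even A \<Longrightarrow> A\<^sup>2 mod 8 \<in> {0, 4}"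
proof -
  have "A mod 8 \<in> {0, 1, 2, 3, 4, 5, 6, 7}" by auto
  moreover have "A\<^sup>2 mod 8 = (A mod 8)\<^sup>2 mod 8" by (simp add: power_mod)
  moreover have "even A \<longleftrightarrow> even (A mod 8)" by presburger
  ultimately show "odd A \<Longrightarrow> A\<^sup>2 mod 8 = 1" "even A \<Longrightarrow> A\<^sup>2 mod 8 \<in> {0, 4}" by auto
qed

text \<open>Squares are 0, 1 or 4 modulo 8, which leaves a finite check. The second alternative is
  the ramified prime 2, the third the inert one; residues 0 and 4 of \<open>d\<close> contradict
  squarefreeness, and residue 7 is the split case.\<close>

lemma norm_mod_8:
  assumes prim: "\<not> (even A \<and> even B)" and d: "d mod 8 \<in> {1, 2, 3, 5, 6}"
  shows "odd (A\<^sup>2 + int d * B\<^sup>2) \<or>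
    (A\<^sup>2 + int d * B\<^sup>2) mod 8 \<in> {2, 6} \<and> odd B \<and> (odd A \<longleftrightarrow> odd d) \<and> d mod 8 \<noteq> 3 \<or>
    (A\<^sup>2 + int d * B\<^sup>2) mod 8 = 4 \<and> d mod 8 = 3"
proof -
  define a where "a = A\<^sup>2 mod 8"
  define b where "b = B\<^sup>2 mod 8"
  define e where "e = int d mod 8"
  define n where "n = (A\<^sup>2 + int d * B\<^sup>2) mod 8"
  have "[A\<^sup>2 + int d * B\<^sup>2 = a + e * b] (mod 8)"
    unfolding a_def b_def e_def by (intro cong_add cong_mult) (simp_all add: cong_def)
  then have n: "n = (a + e * b) mod 8" by (simp add: cong_def n_def)
  have A: "even A \<and> (a = 0 \<or> a = 4) \<or> odd A \<and> a = 1"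
    using square_mod_8[of A] unfolding a_def by blast
  have B: "even B \<and> (b = 0 \<or> b = 4) \<or> odd B \<and> b = 1"
    using square_mod_8[of B] unfolding b_def by blast
  define m where "m = d mod 8"
  have "e = int m" unfolding e_def m_def by (simp add: zmod_int)
  moreover have "odd d \<longleftrightarrow> odd m" unfolding m_def by presburger
  ultimately have e: "odd d \<and> m \<noteq> 3 \<and> (e = 1 \<or> e = 5) \<or> even d \<and> m \<noteq> 3 \<and> (e = 2 \<or> e = 6) \<or>
    m = 3 \<and> e = 3"
    using d[folded m_def] by auto
  have "odd (A\<^sup>2 + int d * B\<^sup>2) \<longleftrightarrow> odd n"
    unfolding n_def by (simp add: dvd_mod_iff)
  moreover have "odd n \<or> n \<in> {2, 6} \<and> odd B \<and> (odd A \<longleftrightarrow> odd d) \<and> m \<noteq> 3 \<or> n = 4 \<and> m = 3"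
    using A B e prim unfolding n by (elim disjE conjE) simp_all
  ultimately show ?thesis by (simp only: n_def m_def)
qed

text \<open>Here \<open>s\<close> is the exact power of 2 in the norm of the primitive vector; its
  parity data are kept because they sharpen the lower bounds for that norm.\<close>

lemma prime_free_2_norm:
  assumes AB: "A \<noteq> 0 \<or> B \<noteq> 0" and d: "d mod 8 \<in> {1, 2, 3, 5, 6}"
  obtains j A0 B0 s where "A = 2 ^ j * A0" "B = 2 ^ j * B0"
    "s * prime_free 2 (A\<^sup>2 + int d * B\<^sup>2) = A0\<^sup>2 + int d * B0\<^sup>2"
    "s = 1 \<or> s = 2 \<and> odd B0 \<and> (odd A0 \<longleftrightarrow> odd d) \<and> d mod 8 \<noteq> 3 \<or> s = 4 \<and> d mod 8 = 3"
proof -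
  have pp: "prime (2 :: int)" by simp
  obtain j A0 B0 where j: "A = 2 ^ j * A0" "B = 2 ^ j * B0" and prim: "\<not> (even A0 \<and> even B0)"
    using common_prime_power[OF pp AB] by metis
  define N where "N = A0\<^sup>2 + int d * B0\<^sup>2"
  have eq: "prime_free 2 (A\<^sup>2 + int d * B\<^sup>2) = prime_free 2 N"
    unfolding j N_def by (rule prime_free_norm_scale[OF pp])
  have 1: "1 * prime_free 2 N = N" if "odd N"
    using that by (simp add: prime_free_not_dvd)
  have 2: "2 * prime_free 2 N = N" if "N mod 8 \<in> {2, 6}"
  proof -
    define n where "n = N div 2"
    have "N mod 8 = 2 \<or> N mod 8 = 6" using that by simp
    then have n: "N = 2 * n" "odd n" unfolding n_def by presburger+
    then show ?thesis using prime_free_eqI[OF pp n(2), of N 1] by simp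
  qed
  have 4: "4 * prime_free 2 N = N" if "N mod 8 = 4"
  proof -
    define n where "n = N div 4"
    have n: "N = 4 * n" "odd n" using that unfolding n_def by presburger+
    then show ?thesis using prime_free_eqI[OF pp n(2), of N 2] by simp
  qed
  have "\<exists>s. s * prime_free 2 N = N \<and>
    (s = 1 \<or> s = 2 \<and> odd B0 \<and> (odd A0 \<longleftrightarrow> odd d) \<and> d mod 8 \<noteq> 3 \<or> s = 4 \<and> d mod 8 = 3)"
    using norm_mod_8[OF prim d, folded N_def] 1 2 4 by blast
  then show thesis using that[OF j] unfolding eq N_def by blast
qed


section \<open>Obstructions for \<open>p = 2\<close>\<close>

text \<open>The critical cases are those with \<open>s > 1\<close>. For \<open>d mod 4 = 1\<close>
  the odd \<open>A0\<close> is a multiple of 3, giving \<open>(9 + 13) / 2\<close>; for even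
  \<open>d\<close> it is even and nonzero, giving \<open>(4 + 14) / 2\<close>; for
  \<open>d mod 8 = 3\<close> the bound is \<open>(1 + 35) / 4\<close>. All are at least 9.\<close>

lemma prime_free_2_norm_ge_9:
  assumes d: "d mod 8 \<in> {1, 2, 3, 5, 6}" and B: "\<not> 3 dvd B"
    and d1: "d mod 4 = 1 \<Longrightarrow> 3 dvd A \<and> d \<ge> 13"
    and d2: "even d \<Longrightarrow> \<not> 3 dvd A \<and> d \<ge> 14"
    and d3: "d mod 4 = 3 \<Longrightarrow> \<not> 3 dvd A \<and> d \<ge> 35"
  shows "9 \<le> prime_free 2 (A\<^sup>2 + int d * B\<^sup>2)"
proof -
  define P where "P = prime_free 2 (A\<^sup>2 + int d * B\<^sup>2)"
  have "B \<noteq> 0" using B by auto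
  then obtain j A0 B0 s where AB: "A = 2 ^ j * A0" "B = 2 ^ j * B0"
    and sN: "s * P = A0\<^sup>2 + int d * B0\<^sup>2"
    and s: "s = 1 \<or> s = 2 \<and> odd B0 \<and> (odd A0 \<longleftrightarrow> odd d) \<and> d mod 8 \<noteq> 3 \<or> s = 4 \<and> d mod 8 = 3"
    unfolding P_def using prime_free_2_norm[OF _ d, of A B] by metis
  have "B0 \<noteq> 0" using \<open>B \<noteq> 0\<close> AB by auto
  then have "1\<^sup>2 \<le> B0\<^sup>2" by (intro square_ge_square) auto
  define D where "D = int d * B0\<^sup>2"
  have dB: "D \<ge> int d" using \<open>1\<^sup>2 \<le> B0\<^sup>2\<close> by (simp add: D_def mult_le_cancel_left1)
  have sP: "s * P = A0\<^sup>2 + D" using sN by (simp add: D_def)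
  have "coprime (3 :: int) (2 ^ j)" by simp
  then have A3: "3 dvd A \<longleftrightarrow> 3 dvd A0" unfolding AB by (simp add: coprime_dvd_mult_right_iff)
  have nz: "1\<^sup>2 \<le> A0\<^sup>2" if "\<not> 3 dvd A" using that A3 by (intro square_ge_square) auto
  have "d mod 4 = 1 \<or> even d \<or> d mod 4 = 3" by presburger
  then have "9 \<le> P"
  proof (elim disjE)
    assume *: "d mod 4 = 1"
    then have "d mod 8 \<noteq> 3" by presburger
    moreover have "3\<^sup>2 \<le> A0\<^sup>2" if "odd A0" using that d1[OF *] A3 by (intro square_ge_square) auto
    moreover have "odd d" using * by presburger
    moreover have "D \<ge> 13" using dB d1[OF *] by linarith
    moreover from this have "A0\<^sup>2 + D \<ge> 13" using zero_le_power2[of A0] by linarith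
    ultimately show ?thesis using s sP by auto
  next
    assume *: "even d"
    then have "d mod 8 \<noteq> 3" by presburger
    moreover have "2\<^sup>2 \<le> A0\<^sup>2" if "even A0" using that d2[OF *] A3 by (intro square_ge_square) auto
    ultimately show ?thesis using s sP dB d2[OF *] nz * by auto
  next
    assume *: "d mod 4 = 3"
    have "d mod 8 = 3" using * d by simp presburger
    then show ?thesis using s sP dB d3[OF *] nz by auto
  qed
  then show ?thesis by (simp add: P_def)
qed

lemma squarefree_not_dvd_square:
  fixes d :: nat
  assumes "squarefree d" "q > 1"
  shows "\<not> q\<^sup>2 dvd d"
  using assms unfolding squarefree_def by auto

lemma S_norm_Euclidean_2_imp:
  assumes d: "d > 0" "squarefree d" and d8: "\<not> [- int d = 1] (mod 8)"
    and E: "S_norm_Euclidean d 2"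
  shows "d \<in> {1, 2, 3, 5, 6, 10, 11, 19}"
proof (rule ccontr)
  assume nd: "\<not> ?thesis"
  have "\<not> 4 dvd d" "\<not> 9 dvd d"
    using squarefree_not_dvd_square[OF d(2), of 2] squarefree_not_dvd_square[OF d(2), of 3] by simp_all
  \<comment> \<open>Among the residues treated below, 9 and 27 are the only values under the bounds
    13, 14 and 35 that are missing from the list.\<close>
  then have ne: "d mod 4 \<noteq> 0" "d \<noteq> 9" "d \<noteq> 27" by (auto simp: dvd_eq_mod_eq_0)
  have "(- int d) mod 8 \<noteq> 1" using d8 by (simp add: cong_def)
  then have "d mod 8 \<noteq> 7" by presburger
  then have "d mod 8 = 1 \<or> d mod 8 = 2 \<or> d mod 8 = 3 \<or> d mod 8 = 5 \<or> d mod 8 = 6"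
    using ne(1) by presburger
  then have d_mod: "d mod 8 \<in> {1, 2, 3, 5, 6}" by simp
  have b1: "d \<ge> 13" if "d mod 4 = 1"
  proof (rule ccontr)
    assume "\<not> d \<ge> 13"
    then have "d = 1 \<or> d = 5 \<or> d = 9" using that by presburger
    then show False using nd ne by auto
  qed
  have b2: "d \<ge> 14" if "even d"
  proof (rule ccontr)
    assume "\<not> d \<ge> 14"
    then have "d = 2 \<or> d = 6 \<or> d = 10" using that ne by presburger
    then show False using nd by auto
  qed
  have b3: "d \<ge> 35" if "d mod 4 = 3"
  proof (rule ccontr)
    assume "\<not> d \<ge> 35"
    then have "d = 3 \<or> d = 11 \<or> d = 19 \<or> d = 27"
      using that \<open>d mod 8 \<noteq> 7\<close> by presburger
    then show False using nd ne by auto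
  qed
  have 36: "prime_free 2 (4 * 3\<^sup>2) = 9" by (rule prime_free_eqI[of _ _ _ 2]) auto
  \<comment> \<open>With \<open>M = 3\<close> these encode \<open>(1 + sqrt_neg d) / 3\<close> for
    even \<open>d\<close>, \<open>sqrt_neg d / 3\<close> for \<open>d mod 4 = 1\<close> and
    \<open>(1 + sqrt_neg d) / 6\<close> for \<open>d mod 4 = 3\<close>.\<close>
  define u v :: int where "u = (if even d then 2 else if d mod 4 = 1 then 0 else 1)"
    and "v = (if d mod 4 = 3 then 1 else 2)"
  have pow: "3 dvd 2 ^ k * c - 3 * a \<longleftrightarrow> 3 dvd c" for k and c a :: int
  proof -
    have "2 ^ k * c - 3 * a = 2 ^ k * c + (- a) * 3" by simp
    then have "3 dvd 2 ^ k * c - 3 * a \<longleftrightarrow> 3 dvd 2 ^ k * c"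
      by (simp only: dvd_add_times_triv_right_iff)
    also have "\<dots> \<longleftrightarrow> 3 dvd c" by (simp add: coprime_dvd_mult_right_iff)
    finally show ?thesis .
  qed
  have "\<not> S_norm_Euclidean d 2"
  proof (rule not_S_norm_Euclidean[OF d(1), where M = 3 and u = u and v = v])
    fix k a b
    have "9 \<le> prime_free 2 ((2 ^ k * u - 3 * a)\<^sup>2 + int d * (2 ^ k * v - 3 * b)\<^sup>2)"
    proof (rule prime_free_2_norm_ge_9[OF d_mod])
      assume "even d"
      then show "\<not> 3 dvd 2 ^ k * u - 3 * a \<and> 14 \<le> d"
        using b2 by (simp add: pow u_def)
    next
      assume *: "d mod 4 = 3"
      then have "odd d" by presburger
      then show "\<not> 3 dvd 2 ^ k * u - 3 * a \<and> 35 \<le> d"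
        using * b3 by (simp only: pow) (simp add: u_def)
    next
      assume *: "d mod 4 = 1"
      then have "odd d" by presburger
      then show "3 dvd 2 ^ k * u - 3 * a \<and> 13 \<le> d"
        using * b1 by (simp only: pow) (simp add: u_def)
    qed (simp add: pow v_def)
    then show "prime_free (int 2) (4 * 3\<^sup>2) \<le>
      prime_free (int 2) ((int 2 ^ k * u - 3 * a)\<^sup>2 + int d * (int 2 ^ k * v - 3 * b)\<^sup>2)"
      using 36 by simp
  qed auto
  then show False using E by simp
qed

section \<open>Obstructions for odd \<open>p\<close>\<close>

lemma S_norm_Euclidean_odd_imp:
  assumes d: "d > 0" "squarefree d" and p: "prime p" "p \<noteq> 2"
    and L: "Legendre (- int d) (int p) \<noteq> 1"
    and E: "S_norm_Euclidean d p"
  shows "d \<in> {1, 2, 3, 7, 11} \<or> d mod 4 = 3 \<and> p dvd d \<and> p\<^sup>2 + d < 16 * p"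
proof (rule ccontr)
  assume nd: "\<not> ?thesis"
  have "odd p" using p prime_odd_nat[of p] prime_ge_2_nat[of p] by auto
  have pow: "prime_free (int p) (2 ^ n) = 2 ^ n" for n
  proof (rule prime_free_not_dvd)
    show "\<not> int p dvd 2 ^ n"
      using p primes_dvd_imp_eq[of p 2] prime_dvd_power[of p 2 n]
      by (metis of_nat_dvd_iff of_nat_numeral of_nat_power two_is_prime_nat)
  qed
  have "\<not> S_norm_Euclidean d p"
  proof (cases "d mod 4 = 3")
    case False
    have "\<not> 4 dvd d" using squarefree_not_dvd_square[OF d(2), of 2] by simp
    then have "d mod 4 \<noteq> 0" by (simp add: dvd_eq_mod_eq_0)
    then have d5: "d \<ge> 5" using nd False by (cases "d \<ge> 5") (auto, presburger)
    show ?thesis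
    \<comment> \<open>The point is \<open>(1 + sqrt_neg d) / 2\<close>. Integers have even
      \<open>a\<close> and \<open>b\<close> here, so both entries stay odd.\<close>
    proof (rule not_S_norm_Euclidean[OF d(1) p(1), where M = 1 and u = 1 and v = 1])
      fix k a b
      assume "quad_int_coords d a b"
      then have ab: "even a" "even b" using False by (simp_all add: quad_int_coords_def)
      have "4 \<le> prime_free (int p) ((int p ^ k * 1 - 1 * a)\<^sup>2 + int d * (int p ^ k * 1 - 1 * b)\<^sup>2)"
      proof (rule prime_free_norm_odd_bound[OF p d(2) L])
        \<comment> \<open>This square makes the ramified condition for \<open>c = 4\<close>
          automatic.\<close>
        have "(int p)\<^sup>2 - 4 * int p + 4 = (int p - 2)\<^sup>2" by (simp add: power2_eq_square algebra_simps)
        then have "(int p)\<^sup>2 - 4 * int p + 4 \<ge> 0" by simp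
        then show "int p * 4 \<le> (int p)\<^sup>2 + int d" using d5 by linarith
      qed (use d5 ab \<open>odd p\<close> in auto)
      then show "prime_free (int p) (4 * 1\<^sup>2) \<le>
          prime_free (int p) ((int p ^ k * 1 - 1 * a)\<^sup>2 + int d * (int p ^ k * 1 - 1 * b)\<^sup>2)"
        using pow[of 2] by simp
    qed simp
  next
    case True
    have d15: "d \<ge> 15"
    proof (rule ccontr)
      assume "\<not> d \<ge> 15"
      then have "d = 3 \<or> d = 7 \<or> d = 11" using True by presburger
      then show False using nd by auto
    qed
    show ?thesis
    \<comment> \<open>The point is \<open>(1 + sqrt_neg d) / 4\<close>; now \<open>2 * a\<close> and
      \<open>2 * b\<close> are even for every integer, and \<open>1 + d\<close> reaches 16.\<close>
    proof (rule not_S_norm_Euclidean[OF d(1) p(1), where M = 2 and u = 1 and v = 1])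
      fix k a b
      have "16 \<le> prime_free (int p) ((int p ^ k * 1 - 2 * a)\<^sup>2 + int d * (int p ^ k * 1 - 2 * b)\<^sup>2)"
      proof (rule prime_free_norm_odd_bound[OF p d(2) L])
        assume "p dvd d"
        then have "16 * p \<le> p\<^sup>2 + d" using nd True by simp
        then have "int (16 * p) \<le> int (p\<^sup>2 + d)" by (simp only: of_nat_le_iff)
        then show "int p * 16 \<le> (int p)\<^sup>2 + int d" by simp
      qed (use d15 \<open>odd p\<close> in auto)
      then show "prime_free (int p) (4 * 2\<^sup>2) \<le>
          prime_free (int p) ((int p ^ k * 1 - 2 * a)\<^sup>2 + int d * (int p ^ k * 1 - 2 * b)\<^sup>2)"
        using pow[of 4] by simp
    qed simp
  qed
  then show False using E by simp
qed

section \<open>Covering the plane by unit discs\<close>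

lemma quad_form_less:
  assumes "\<bar>u\<bar> \<le> A" "\<bar>v\<bar> \<le> B" "A\<^sup>2 + of_nat d * B\<^sup>2 < M"
  shows "quad_form d u v < M"
proof -
  have "u\<^sup>2 \<le> A\<^sup>2" "v\<^sup>2 \<le> B\<^sup>2" using assms by (simp_all add: abs_le_square_iff[symmetric])
  then have "u\<^sup>2 + of_nat d * v\<^sup>2 \<le> A\<^sup>2 + of_nat d * B\<^sup>2" by (intro add_mono mult_left_mono) auto
  then show ?thesis using assms by (simp add: quad_form_def)
qed

text \<open>Folding reduces covering arguments to \<open>0 \<le> s \<le> 1/2\<close>: the second
  nearest integer is \<open>b + \<sigma>\<close>, and the multiples of \<open>t\<close> by 2 and 4
  are compared with \<open>2 * b + \<sigma>\<close> and \<open>4 * b + \<sigma>\<close>.\<close>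

lemma fold_nearest_int:
  fixes t :: rat
  obtains b \<sigma> :: int and s :: rat
    where "t = of_int b + of_int \<sigma> * s" "0 \<le> s" "s \<le> 1/2" "\<sigma> = 1 \<or> \<sigma> = -1"
proof -
  define b where "b = round t"
  have *: "\<bar>of_int b - t\<bar> \<le> 1/2" unfolding b_def by (rule of_int_round_abs_le)
  show thesis
  proof (cases "t \<ge> of_int b")
    case True
    show thesis by (rule that[of b 1 "t - of_int b"]) (use * True in auto)
  next
    case False
    show thesis by (rule that[of b "-1" "of_int b - t"]) (use * False in auto)
  qed
qed

text \<open>Rounding \<open>x\<close> costs at most 1/4 of the norm, so the unit discs of a row
  cover a whole strip around it.\<close>

lemma covered_even:
  assumes "d mod 4 \<noteq> 3" "\<bar>y - of_int b\<bar> \<le> \<tau>" "of_nat d * \<tau>\<^sup>2 < 3/4"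
  shows "covered d p x y"
proof -
  have "\<bar>of_int (round x) - x\<bar> \<le> 1/2" by (rule of_int_round_abs_le)
  then have "quad_form d (x - of_int (2 * round x) / 2) (y - of_int (2 * b) / 2) < 1"
    using assms by (intro quad_form_less[of _ "1/2" _ \<tau>]) (auto simp: power2_eq_square abs_minus_commute)
  moreover have "quad_int_coords d (2 * round x) (2 * b)" using assms by (simp add: quad_int_coords_def)
  ultimately show ?thesis unfolding covered_def by blast
qed

text \<open>The same strip argument for rows at height \<open>b / 2\<close>, whose lattice points
  are shifted by \<open>b / 2\<close>; this shift is built into \<open>a\<close>.\<close>

lemma covered_odd:
  assumes "d mod 4 = 3" "\<bar>2 * y - of_int b\<bar> \<le> \<tau>" "of_nat d * \<tau>\<^sup>2 < 3"
  shows "covered d p x y"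
proof -
  define a where "a = 2 * round (x - of_int b / 2) + b"
  have "\<bar>of_int (round (x - of_int b / 2)) - (x - of_int b / 2)\<bar> \<le> 1/2" by (rule of_int_round_abs_le)
  moreover have "x - of_int a / 2 = - (of_int (round (x - of_int b / 2)) - (x - of_int b / 2))"
    by (simp add: a_def field_simps)
  ultimately have "\<bar>x - of_int a / 2\<bar> \<le> 1/2" by (simp only: abs_minus_cancel)
  moreover have "\<bar>y - of_int b / 2\<bar> \<le> \<tau> / 2" using assms(2) by linarith
  ultimately have "quad_form d (x - of_int a / 2) (y - of_int b / 2) < 1"
    using assms(3) by (intro quad_form_less[of _ "1/2" _ "\<tau>/2"]) (auto simp: power2_eq_square)
  moreover have "quad_int_coords d a b" using assms by (simp add: quad_int_coords_def a_def)
  ultimately show ?thesis unfolding covered_def by blast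
qed


text \<open>Strips of half-width \<tau> = 1/2 cover everything: the conditions read
  \<open>d < 3\<close> and \<open>d < 12\<close> in the two cases.\<close>

lemma S_norm_Euclidean_norm_Euclidean:
  assumes "d \<in> {1, 2, 3, 7, 11}" "prime p"
  shows "S_norm_Euclidean d p"
proof (rule S_norm_EuclideanI)
  fix x y :: rat
  have "covered d p x y"
  proof (cases "d mod 4 = 3")
    case True
    have "\<bar>2 * y - of_int (round (2 * y))\<bar> \<le> 1/2"
      using of_int_round_abs_le[of "2 * y"] by (simp add: abs_minus_commute)
    then show ?thesis
      by (rule covered_odd[OF True]) (use True assms in \<open>auto simp: power2_eq_square\<close>)
  next
    case False
    have "\<bar>y - of_int (round y)\<bar> \<le> 1/2"
      using of_int_round_abs_le[of y] by (simp add: abs_minus_commute)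
    then show ?thesis
      by (rule covered_even[OF False]) (use False assms in \<open>auto simp: power2_eq_square\<close>)
  qed
  then show "\<exists>k. covered d p (of_nat p ^ k * x) (of_nat p ^ k * y)"
    by (intro exI[of _ 0]) simp
qed (use assms in auto)

text \<open>If the distance \<open>s\<close> to the nearest integer exceeds 1/3, then
  \<open>1 - 2 * s\<close> is below 1/3.\<close>

lemma near_int_double:
  fixes t :: rat
  obtains b :: int where "\<bar>t - of_int b\<bar> \<le> 1/3 \<or> \<bar>2 * t - of_int b\<bar> \<le> 1/3"
proof -
  obtain b \<sigma> :: int and s :: rat
    where t: "t = of_int b + of_int \<sigma> * s" and s: "0 \<le> s" "s \<le> 1/2" and \<sigma>: "\<sigma> = 1 \<or> \<sigma> = -1"
    by (rule fold_nearest_int)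
  show thesis
  proof (cases "s \<le> 1/3")
    case True
    then have "\<bar>t - of_int b\<bar> \<le> 1/3" using t s \<sigma> by auto
    then show thesis using that by blast
  next
    case False
    then have "\<bar>2 * t - of_int (2 * b + \<sigma>)\<bar> \<le> 1/3" using t s \<sigma> by (auto simp: abs_le_iff)
    then show thesis using that by blast
  qed
qed

text \<open>After a possible doubling, \<tau> = 1/3 suffices; the strip conditions become
  \<open>d < 27/4\<close> and \<open>d < 27\<close>.\<close>

lemma S_norm_Euclidean_2_doubling:
  assumes d: "d \<in> {5, 6, 19}"
  shows "S_norm_Euclidean d 2"
proof (rule S_norm_EuclideanI)
  fix x y :: rat
  have "covered d 2 x y \<or> covered d 2 (2 * x) (2 * y)"
  proof (cases "d mod 4 = 3")
    case True
    obtain b :: int where "\<bar>2 * y - of_int b\<bar> \<le> 1/3 \<or> \<bar>2 * (2 * y) - of_int b\<bar> \<le> 1/3"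
      by (rule near_int_double)
    then show ?thesis
      using covered_odd[OF True, of _ b "1/3"] True d by (auto simp: power2_eq_square)
  next
    case False
    obtain b :: int where "\<bar>y - of_int b\<bar> \<le> 1/3 \<or> \<bar>2 * y - of_int b\<bar> \<le> 1/3"
      by (rule near_int_double)
    then show ?thesis
      using covered_even[OF False, of _ b "1/3"] False d by (auto simp: power2_eq_square)
  qed
  then show "\<exists>k. covered d 2 (of_nat 2 ^ k * x) (of_nat 2 ^ k * y)"
  proof
    assume "covered d 2 x y"
    then show ?thesis by (intro exI[of _ 0]) simp
  next
    assume "covered d 2 (2 * x) (2 * y)"
    then show ?thesis by (intro exI[of _ 1]) simp
  qed
qed (use d in auto)

section \<open>Larger discs around the ramified prime ideal\<close>

text \<open>For even \<open>d\<close> the elements \<open>2 * c + b * sqrt_neg d\<close> have even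
  norm, so discs of squared radius 2 around them are allowed.\<close>

lemma covered_ramified_2:
  assumes d: "d mod 4 = 2" and "\<bar>x - 2 * of_int c\<bar> \<le> A" "\<bar>y - of_int b\<bar> \<le> B"
    and "A\<^sup>2 + of_nat d * B\<^sup>2 < 2"
  shows "covered d 2 x y"
proof -
  have "quad_form d (x - of_int (4 * c) / 2) (y - of_int (2 * b) / 2) < of_nat 2"
    using assms by (intro quad_form_less[of _ A _ B]) auto
  moreover have "quad_int_coords d (4 * c) (2 * b)" using d by (simp add: quad_int_coords_def)
  moreover have "4 * int 2 dvd (4 * c)\<^sup>2 + int d * (2 * b)\<^sup>2"
  proof -
    have "even d" using d by presburger
    then obtain e where "d = 2 * e" by blast
    then have "(4 * c)\<^sup>2 + int d * (2 * b)\<^sup>2 = (4 * int 2) * (2 * c\<^sup>2 + int e * b\<^sup>2)"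
      by (simp add: power2_eq_square algebra_simps)
    then show ?thesis by (simp only: dvd_triv_left)
  qed
  ultimately show ?thesis unfolding covered_def by blast
qed

lemma S_norm_Euclidean_10_2: "S_norm_Euclidean 10 2"
proof (rule S_norm_EuclideanI)
  fix x y :: rat
  obtain b \<sigma> :: int and s :: rat
    where y: "y = of_int b + of_int \<sigma> * s" and s: "0 \<le> s" "s \<le> 1/2" and \<sigma>: "\<sigma> = 1 \<or> \<sigma> = -1"
    by (rule fold_nearest_int)
  \<comment> \<open>The ideal points in a row have spacing 2, hence \<open>x / 2\<close> is
    folded.\<close>
  obtain c \<rho> :: int and e :: rat
    where x: "x / 2 = of_int c + of_int \<rho> * e" and e: "0 \<le> e" "e \<le> 1/2" and \<rho>: "\<rho> = 1 \<or> \<rho> = -1"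
    by (rule fold_nearest_int)
  have x': "x = 2 * of_int c + 2 * of_int \<rho> * e" using x by simp
  have small: "covered 10 2 x' y'" if "\<bar>y' - of_int b'\<bar> \<le> 27/100" for x' y' and b' :: int
    by (rule covered_even[OF _ that]) (simp_all add: power2_eq_square)
  \<comment> \<open>The strips catch \<open>y\<close>, \<open>2 * y\<close> or \<open>4 * y\<close>
    unless \<open>s\<close> lies between 127/400 and 73/200. In that gap the large disc catches the
    point for small \<open>e\<close> and its double for large \<open>e\<close>.\<close>
  consider "s \<le> 27/100" | "s \<ge> 73/200" | "27/100 \<le> s" "s \<le> 127/400"
    | "127/400 \<le> s" "s \<le> 73/200" "e \<le> 81/200" | "127/400 \<le> s" "s \<le> 73/200" "81/200 \<le> e"
    by linarith
  then have "\<exists>k\<le>2. covered 10 2 (2 ^ k * x) (2 ^ k * y)"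
  proof cases
    case 1
    have "covered 10 2 x y" by (rule small[of _ b]) (use 1 y s \<sigma> in auto)
    then show ?thesis by (intro exI[of _ 0]) simp
  next
    case 2
    have "covered 10 2 (2 * x) (2 * y)"
      by (rule small[of _ "2 * b + \<sigma>"]) (use 2 y s \<sigma> in \<open>auto simp: abs_le_iff\<close>)
    then show ?thesis by (intro exI[of _ 1]) simp
  next
    case 3
    have "covered 10 2 (4 * x) (4 * y)"
      by (rule small[of _ "4 * b + \<sigma>"]) (use 3 y s \<sigma> in \<open>auto simp: abs_le_iff\<close>)
    then show ?thesis by (intro exI[of _ 2]) simp
  next
    case 4
    have "covered 10 2 x y"
      by (rule covered_ramified_2[of _ _ c "81/100" _ b "73/200"])
        (use 4 x' y s e \<sigma> \<rho> in \<open>auto simp: power2_eq_square\<close>)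
    then show ?thesis by (intro exI[of _ 0]) simp
  next
    case 5
    have "covered 10 2 (2 * x) (2 * y)"
      by (rule covered_ramified_2[of _ _ "2 * c + \<rho>" "38/100" _ "2 * b + \<sigma>" "73/200"])
        (use 5 x' y s e \<sigma> \<rho> in \<open>auto simp: power2_eq_square abs_le_iff\<close>)
    then show ?thesis by (intro exI[of _ 1]) simp
  qed
  then show "\<exists>k. covered 10 2 (of_nat 2 ^ k * x) (of_nat 2 ^ k * y)" by auto
qed auto

text \<open>When \<open>p\<close> divides \<open>d\<close>, the integers
  \<open>(p * c + b * sqrt_neg d) / 2\<close> have norm divisible by \<open>p\<close>; 4 and
  \<open>p\<close> are coprime, so the two divisibilities combine.\<close>

lemma covered_ramified_odd:
  assumes d: "d mod 4 = 3" and p: "odd p" "p dvd d" and bc: "even (c - b)"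
    and "\<bar>x - of_nat p * of_int c / 2\<bar> \<le> A" "\<bar>2 * y - of_int b\<bar> \<le> B"
    and "4 * A\<^sup>2 + of_nat d * B\<^sup>2 < 4 * of_nat p"
  shows "covered d p x y"
proof -
  have "\<bar>y - of_int b / 2\<bar> \<le> B / 2" using assms(6) by linarith
  then have "quad_form d (x - of_int (int p * c) / 2) (y - of_int b / 2) < of_nat p"
    using assms by (intro quad_form_less[of _ A _ "B / 2"]) (auto simp: power2_eq_square)
  moreover have co: "quad_int_coords d (int p * c) b" using d p bc by (auto simp: quad_int_coords_def)
  moreover have "4 * int p dvd (int p * c)\<^sup>2 + int d * b\<^sup>2"
  proof (rule divides_mult)
    show "4 dvd (int p * c)\<^sup>2 + int d * b\<^sup>2" by (rule quad_int_coords_norm[OF co])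
    show "int p dvd (int p * c)\<^sup>2 + int d * b\<^sup>2" using p by (simp add: power2_eq_square)
    have "coprime (2 ^ 2) (int p)" using p by (simp only: coprime_power_left_iff) simp
    then show "coprime 4 (int p)" by simp
  qed
  ultimately show ?thesis unfolding covered_def by blast
qed

text \<open>Here \<open>s\<close> is the distance from \<open>2 * y\<close> to the nearest row of lattice points, and \<open>e\<close> the
  distance from \<open>x\<close> to the nearest point of the ramified prime ideal in that row; the three
  inequalities say that the unit discs, that point and its neighbour in the second nearest row
  all fail.\<close>

lemma not_covered_ramified:
  assumes d: "d mod 4 = 3" and p: "odd p" "p dvd d" and nc: "\<not> covered d p x y"
  obtains e s :: rat where "0 \<le> e" "e \<le> of_nat p / 2" "0 \<le> s" "s \<le> 1/2" "3 \<le> of_nat d * s\<^sup>2"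
    "4 * of_nat p \<le> 4 * e\<^sup>2 + of_nat d * s\<^sup>2"
    "4 * of_nat p \<le> 4 * (of_nat p / 2 - e)\<^sup>2 + of_nat d * (1 - s)\<^sup>2"
proof -
  obtain b \<sigma> :: int and s :: rat
    where y: "2 * y = of_int b + of_int \<sigma> * s" and s: "0 \<le> s" "s \<le> 1/2" and \<sigma>: "\<sigma> = 1 \<or> \<sigma> = -1"
    by (rule fold_nearest_int)
  \<comment> \<open>In row \<open>b\<close> the ideal points have first coordinate
    \<open>p * (c + b / 2)\<close>; \<open>x\<close> is folded at the nearest one.\<close>
  obtain c \<rho> :: int and e' :: rat
    where x: "x / of_nat p - of_int b / 2 = of_int c + of_int \<rho> * e'" and e': "0 \<le> e'" "e' \<le> 1/2"
      and \<rho>: "\<rho> = 1 \<or> \<rho> = -1"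
    by (rule fold_nearest_int)
  define e where "e = of_nat p * e'"
  have p0: "p > 0" using p by (cases p) auto
  have e: "0 \<le> e" "e \<le> of_nat p / 2"
    using e' p0 mult_left_mono[OF e'(2), of "of_nat p"] by (simp_all add: e_def)
  have "x = of_nat p * (of_int b / 2 + of_int c + of_int \<rho> * e')"
    using x p0 by (simp add: field_simps)
  then have x': "x - of_nat p * of_int (2 * c + b) / 2 = of_int \<rho> * e"
    by (simp add: e_def algebra_simps)
  \<comment> \<open>An adjacent row has the other parity, so its ideal points are shifted by
    \<open>p / 2\<close>; \<rho> chooses the side towards \<open>x\<close>.\<close>
  have x'': "x - of_nat p * of_int (2 * c + b + \<rho>) / 2 = of_int \<rho> * (e - of_nat p / 2)"
    using x' by (simp add: algebra_simps add_divide_distrib)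
  have y': "2 * y - of_int b = of_int \<sigma> * s" "2 * y - of_int (b + \<sigma>) = of_int \<sigma> * (s - 1)"
    using y by (simp_all add: algebra_simps)
  have \<sigma>\<rho>: "\<bar>of_int \<sigma> :: rat\<bar> = 1" "\<bar>of_int \<rho> :: rat\<bar> = 1" using \<sigma> \<rho> by auto
  have near: "\<bar>x - of_nat p * of_int (2 * c + b) / 2\<bar> \<le> e" "\<bar>2 * y - of_int b\<bar> \<le> s"
    "\<bar>x - of_nat p * of_int (2 * c + b + \<rho>) / 2\<bar> \<le> of_nat p / 2 - e" "\<bar>2 * y - of_int (b + \<sigma>)\<bar> \<le> 1 - s"
    unfolding x' x'' y' abs_mult \<sigma>\<rho> using e s by auto
  show thesis
  proof (rule that[OF e s])
    show "3 \<le> of_nat d * s\<^sup>2"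
      using covered_odd[OF d near(2)] nc by (meson not_le)
    have "even (2 * c + b - b)" by simp
    from covered_ramified_odd[OF d p this near(1,2)] nc
    show "4 * of_nat p \<le> 4 * e\<^sup>2 + of_nat d * s\<^sup>2" by (meson not_le)
    have "even (2 * c + b + \<rho> - (b + \<sigma>))" using \<sigma> \<rho> by auto
    from covered_ramified_odd[OF d p this near(3,4)] nc
    show "4 * of_nat p \<le> 4 * (of_nat p / 2 - e)\<^sup>2 + of_nat d * (1 - s)\<^sup>2" by (meson not_le)
  qed
qed

text \<open>A point not covered yields \<open>e\<close> and \<open>s\<close> in a strip bounded
  below by the unit-disc condition. The strip is cut into rectangles, each inside one of the two
  large discs.\<close>

lemma S_norm_Euclidean_ramified:
  assumes dp: "(d, p) \<in> {(15, 3), (15, 5), (35, 5), (35, 7)}"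
  shows "S_norm_Euclidean d p"
proof (rule S_norm_EuclideanI)
  fix x y :: rat
  have sq: "u\<^sup>2 \<le> v\<^sup>2" if "0 \<le> u" "u \<le> v" for u v :: rat
    using that by (rule power_mono[rotated])
  have "covered d p x y"
  proof (rule ccontr)
    assume nc: "\<not> covered d p x y"
    obtain e s :: rat where e: "0 \<le> e" "e \<le> of_nat p / 2" and s: "0 \<le> s" "s \<le> 1/2"
      and 1: "3 \<le> of_nat d * s\<^sup>2"
      and 2: "4 * of_nat p \<le> 4 * e\<^sup>2 + of_nat d * s\<^sup>2"
      and 3: "4 * of_nat p \<le> 4 * (of_nat p / 2 - e)\<^sup>2 + of_nat d * (1 - s)\<^sup>2"
      by (rule not_covered_ramified[OF _ _ _ nc]) (use dp in auto)
    \<comment> \<open>The first norm is largest at the corner \<open>(e2, s2)\<close>, the second at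
      \<open>(e1, s1)\<close>; one corner settles a rectangle.\<close>
    have box: "False" if "e1 \<le> e" "e \<le> e2" "s1 \<le> s" "s \<le> s2"
      "4 * e2\<^sup>2 + of_nat d * s2\<^sup>2 < 4 * of_nat p \<or>
       4 * (of_nat p / 2 - e1)\<^sup>2 + of_nat d * (1 - s1)\<^sup>2 < 4 * of_nat p" for e1 e2 s1 s2
    proof -
      have "4 * e\<^sup>2 + of_nat d * s\<^sup>2 \<le> 4 * e2\<^sup>2 + of_nat d * s2\<^sup>2"
        using sq[of e e2] sq[of s s2] that e s by (intro add_mono mult_left_mono) auto
      moreover have "4 * (of_nat p / 2 - e)\<^sup>2 + of_nat d * (1 - s)\<^sup>2
          \<le> 4 * (of_nat p / 2 - e1)\<^sup>2 + of_nat d * (1 - s1)\<^sup>2"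
        using sq[of "of_nat p / 2 - e" "of_nat p / 2 - e1"] sq[of "1 - s" "1 - s1"] that e s
        by (intro add_mono mult_left_mono) auto
      ultimately show False using that 2 3 by linarith
    qed
    \<comment> \<open>The values used, 44/100 and 29/100, lie just below the square roots of 3/15
      and 3/35.\<close>
    have s_ge: "\<tau> \<le> s" if "of_nat d * \<tau>\<^sup>2 < 3" for \<tau>
    proof (rule ccontr)
      assume "\<not> \<tau> \<le> s"
      then have "of_nat d * s\<^sup>2 \<le> of_nat d * \<tau>\<^sup>2" using sq[of s \<tau>] s by (intro mult_left_mono) auto
      then show False using that 1 by linarith
    qed
    consider "d = 15" "p = 3" | "d = 15" "p = 5" | "d = 35" "p = 5" | "d = 35" "p = 7"
      using dp by auto
    then show False
    proof cases
      case 1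
      have "44/100 \<le> s" by (rule s_ge) (simp add: 1 power2_eq_square)
      then show False
        using box[of 0 "3/4" "44/100" "1/2"] box[of "3/4" "3/2" "44/100" "1/2"] e s
        by (cases "e \<le> 3/4") (simp_all add: 1 power2_eq_square)
    next
      case 2
      have "44/100 \<le> s" by (rule s_ge) (simp add: 2 power2_eq_square)
      then show False
        using box[of 0 "5/4" "44/100" "1/2"] box[of "5/4" "5/2" "44/100" "1/2"] e s
        by (cases "e \<le> 5/4") (simp_all add: 2 power2_eq_square)
    next
      case 3
      have s29: "29/100 \<le> s" by (rule s_ge) (simp add: 3 power2_eq_square)
      \<comment> \<open>For \<open>s = 1/2\<close> the first disc reaches only to about
        \<open>e = 1.68\<close>, while for \<open>s = 29/100\<close> the second starts near
        \<open>e = 1.73\<close>. No single cut in \<open>e\<close> works, so \<open>s\<close> is cut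
        too.\<close>
      show False
      proof (cases "s \<le> 2/5")
        case True
        then show False
          using box[of 0 "9/5" "29/100" "2/5"] box[of "9/5" "5/2" "29/100" "2/5"] e s29
          by (cases "e \<le> 9/5") (simp_all add: 3 power2_eq_square)
      next
        case False
        then show False
          using box[of 0 "8/5" "2/5" "1/2"] box[of "8/5" "5/2" "2/5" "1/2"] e s
          by (cases "e \<le> 8/5") (simp_all add: 3 power2_eq_square)
      qed
    next
      case 4
      have "29/100 \<le> s" by (rule s_ge) (simp add: 4 power2_eq_square)
      then show False
        using box[of 0 "21/10" "29/100" "1/2"] box[of "21/10" "7/2" "29/100" "1/2"] e s
        by (cases "e \<le> 21/10") (simp_all add: 4 power2_eq_square)
    qed
  qed
  then show "\<exists>k. covered d p (of_nat p ^ k * x) (of_nat p ^ k * y)"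
    by (intro exI[of _ 0]) simp
qed (use dp in auto)


section \<open>The finite lists\<close>

lemma S_norm_Euclidean_odd_imp_small:
  assumes d: "d > 0" "squarefree d" and p: "prime p" "p \<noteq> 2"
    and L: "Legendre (- int d) (int p) \<noteq> 1"
    and E: "S_norm_Euclidean d p"
  shows "d \<in> {1, 2, 3, 7, 11} \<or> (d, p) \<in> {(15, 3), (15, 5), (35, 5), (35, 7)}"
proof (cases "d \<in> {1, 2, 3, 7, 11}")
  case False
  then have d4: "d mod 4 = 3" and dvd: "p dvd d" and less: "p\<^sup>2 + d < 16 * p"
    using S_norm_Euclidean_odd_imp[OF assms] by blast+
  have "p * p < 16 * p" using less unfolding power2_eq_square by linarith
  then have "p < 16" by simp
  then have "p \<in> set (filter prime [0..<16])" using p by simp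
  also have "filter prime [0..<16] = [2, 3, 5, 7, 11, 13::nat]" by code_simp
  finally have "p = 3 \<or> p = 5 \<or> p = 7 \<or> p = 11 \<or> p = 13" using p by auto
  \<comment> \<open>For \<open>p = 3\<close> the inequality leaves 3, 15 and 27; the last is not
    squarefree. For \<open>p = 11\<close> only 11 is left, for \<open>p = 13\<close>
    nothing.\<close>
  moreover have "d \<noteq> 27" using squarefree_not_dvd_square[OF d(2), of 3] by auto
  moreover have "d \<noteq> 3" "d \<noteq> 7" "d \<noteq> 11" using False by auto
  ultimately show ?thesis
    using d4 dvd less
    by (elim disjE; simp; presburger)
qed simp

lemma Legendre_eq_1I:
  assumes "[y\<^sup>2 = a] (mod p)" "\<not> p dvd a"
  shows "Legendre a p = 1"
  using assms unfolding Legendre_def QuadRes_def cong_0_iff by auto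

theorem theorem3:
  fixes d p :: nat
  assumes "d > 0" and "squarefree d" and "prime p"
  shows "(p \<ge> 11 \<and> Legendre (- int d) (int p) \<noteq> 1 \<longrightarrow>
            S_norm_Euclidean d p \<longrightarrow> d \<in> {1, 2, 3, 7, 11})
       \<and> (p = 2 \<and> \<not> [- int d = 1] (mod 8) \<longrightarrow>
            (S_norm_Euclidean d p \<longleftrightarrow> d \<in> {1, 2, 3, 5, 6, 10, 11, 19}))
       \<and> (p \<in> {3, 5, 7} \<and> Legendre (- int d) (int p) \<noteq> 1 \<longrightarrow>
            (S_norm_Euclidean d p \<longleftrightarrow>
               (p = 3 \<and> d \<in> {1, 3, 7, 11, 15}) \<or>
               (p = 5 \<and> d \<in> {2, 3, 7, 15, 35}) \<or>
               (p = 7 \<and> d \<in> {1, 2, 7, 11, 35})))"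
proof (intro conjI impI)
  assume h: "p \<ge> 11 \<and> Legendre (- int d) (int p) \<noteq> 1" and E: "S_norm_Euclidean d p"
  then show "d \<in> {1, 2, 3, 7, 11}"
    using S_norm_Euclidean_odd_imp_small[OF assms _ _ E] by auto
next
  assume h: "p = 2 \<and> \<not> [- int d = 1] (mod 8)"
  show "S_norm_Euclidean d p \<longleftrightarrow> d \<in> {1, 2, 3, 5, 6, 10, 11, 19}"
  proof
    assume "S_norm_Euclidean d p"
    then show "d \<in> {1, 2, 3, 5, 6, 10, 11, 19}"
      using S_norm_Euclidean_2_imp[OF assms(1,2)] h by simp
  next
    assume "d \<in> {1, 2, 3, 5, 6, 10, 11, 19}"
    then have "d \<in> {1, 2, 3, 7, 11} \<or> d \<in> {5, 6, 19} \<or> d = 10" by blast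
    then show "S_norm_Euclidean d p"
      using S_norm_Euclidean_norm_Euclidean[OF _ assms(3), of d] S_norm_Euclidean_2_doubling[of d]
        S_norm_Euclidean_10_2 h by auto
  qed
next
  assume h: "p \<in> {3, 5, 7} \<and> Legendre (- int d) (int p) \<noteq> 1"
  let ?list = "(p = 3 \<and> d \<in> {1, 3, 7, 11, 15}) \<or> (p = 5 \<and> d \<in> {2, 3, 7, 15, 35}) \<or>
    (p = 7 \<and> d \<in> {1, 2, 7, 11, 35})"
  show "S_norm_Euclidean d p \<longleftrightarrow> ?list"
  proof
    assume E: "S_norm_Euclidean d p"
    \<comment> \<open>These are the pairs with \<open>d\<close> in \<open>{1, 2, 3, 7, 11}\<close>
      for which \<open>p\<close> splits; this is why the three lists differ.\<close>
    have "(d, p) \<notin> {(2, 3), (1, 5), (11, 5), (3, 7)}"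
    proof
      assume "(d, p) \<in> {(2, 3), (1, 5), (11, 5), (3, 7)}"
      then have "Legendre (- int d) (int p) = 1"
        using Legendre_eq_1I[of 1 "-2" 3] Legendre_eq_1I[of 2 "-1" 5]
          Legendre_eq_1I[of 2 "-11" 5] Legendre_eq_1I[of 2 "-3" 7]
        by (auto simp: cong_def)
      then show False using h by simp
    qed
    then show ?list
      using S_norm_Euclidean_odd_imp_small[OF assms _ _ E] h by auto
  next
    assume ?list
    then have "d \<in> {1, 2, 3, 7, 11} \<or> (d, p) \<in> {(15, 3), (15, 5), (35, 5), (35, 7)}" by auto
    then show "S_norm_Euclidean d p"
      using S_norm_Euclidean_norm_Euclidean[OF _ assms(3)] S_norm_Euclidean_ramified by blast
  qed
qed

end
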